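(* Let $T>0$, $1\le p,q<\infty$, $1<r<\infty$, let $\mathcal{X},\mathcal{Y}$ be reflexive Banach spaces, $\mathbb{X}:=L^p(0,T;\mathcal{X})$, $\mathbb{Y}:=L^q(0,T;\mathcal{Y})$. Let $F:\mathcal{D}(F)=\mathbb{X}\to\mathbb{Y}$ be given by $(F\vartheta)(t)=S(t)K[\vartheta(t)]$, where $K:\mathcal{X}\to\mathcal{Y}$ is linear and compact and $S(t)\in\mathcal{L}(\mathcal{Y})$ for $t\in[0,T]$ with $\sup_{t\in(0,T)}\|S(t)\|<\infty$; write $F_t:=S(t)K$. Assume that $C([0,T];\mathcal{X})\cap\mathcal{D}(F)$ is dense in $\mathcal{D}(F)$ and that, for fixed $t\in[0,T]$, $\Omega_t:\mathcal{X}\to[0,+\infty]$ is proper, convex and lower semi-continuous, that $\mathcal{D}(F_t)\cap\mathcal{D}(\Omega_t)\neq\emptyset$, and that the level sets $\{x\in\mathcal{X}:\Omega_t(x)\le c\}$ are weakly sequentially pre-compact. Let $\alpha_t:[0,\infty)\to[0,\infty)$ be an index function with $\alpha_t(\delta)\to0$ and $\delta^r/\alpha_t(\delta)\to0$ as $\delta\to0$. Then the Tikhonov functional $$\mathcal{J}_{t,\alpha}^\delta(x):=\frac1r\|F_t(x)-y^\delta(t)\|_{\mathcal{Y}}^r+\alpha_t\Omega_t(x),\qquad x\in\mathcal{D}(F_t),$$ has a minimizer $x_{t,\alpha}^\delta\in\mathcal{D}(F_t)$, and $\widetilde R(t,y^\delta(t),\alpha):=x_{t,\alpha}^\delta$ is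 a temporal regularization method in the following sense: if $\{\delta_n\}\subset(0,\infty)$ is a sequence with $\delta_n\to0$ as $n\to\infty$, then the sequence $\{x_{t,\alpha(\delta_n)}^{\delta_n}\}$ (with $\alpha(\delta_n):=\alpha_t(\delta_n)$) has a weakly converging subsequence whose weak limit is an $\Omega_t$-minimizing solution $\vartheta^+(t)\in\mathcal{X}$ of $F_t(\vartheta(t))=y(t)$.
   Context: $L^p(0,T;\mathcal{X})$ is the Lebesgue-Bochner space of strongly measurable functions $u:(0,T)\to\mathcal{X}$ with $\int_0^T\|u(t)\|_{\mathcal{X}}^p\,\mathrm{d}t<\infty$. $\mathcal{D}(F_t):=\{\vartheta(t):\vartheta\in C([0,T];\mathcal{X})\cap\mathcal{D}(F)\}$ and $\mathcal{D}(\Omega_t):=\{x\in\mathcal{X}:\Omega_t(x)<\infty\}$. An index function is a strictly increasing continuous function $[0,\infty)\to[0,\infty)$ vanishing at $0$. An $\Omega_t$-minimizing solution is a solution of $F_t(x)=y(t)$ minimizing $\Omega_t$ among all solutions. Standing assumptions on the data: $y\in\mathbb{Y}$ is the exact data, and for each noise level $\delta>0$ the noisy data $y^\delta\in\mathbb{Y}$ satisfy $\|y-y^\delta\|_{\mathbb{Y}}<\delta$ and $y^\delta(t)\in F_t(\mathcal{D}(F_t))$ for all $t\in[0,T]$. There exists a solution of $F(\vartheta)=y$ lying in $C([0,T];\mathcal{X})\cap\mathcal{D}(F)$, so that $y(t)\in F_t(\mathcal{D}(F_t))$ for all $t\in[0,T]$.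
   Formalization: The convergence claim is proved for almost every t (the null set may depend on the sequence δ_n) rather than for every fixed t, and only at those t where some solution of F_t(x)=y(t) has finite penalty Ω_t(x); without these changes it is false. *)

theory Defs
  imports "HOL-Analysis.Analysis"
begin

text \<open>
  Bochner integrability in HOL-Analysis requires a second countable range. The Banach spaces here
  may be non-separable, so strong measurability is defined directly: an a.e. limit of simple
  functions.
\<close>

definition strongly_measurable :: "'a measure \<Rightarrow> ('a \<Rightarrow> 'b::real_normed_vector) \<Rightarrow> bool" where
  "strongly_measurable M u \<longleftrightarrow>
     (\<exists>s. (\<forall>n. simple_function M (s n)) \<and> (AE t in M. (\<lambda>n. s n t) \<longlonglongrightarrow> u t))"

text \<open>
  Elements of \<open>L\<^sup>p(0,T;X)\<close> are represented by functions on the reals whose values outside the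
  interval \<open>(0,T)\<close> are irrelevant for membership and norm.
\<close>

definition bochner_space :: "real \<Rightarrow> real \<Rightarrow> (real \<Rightarrow> 'b::real_normed_vector) set" where
  "bochner_space p T =
     {u. strongly_measurable (lebesgue_on {0<..<T}) u \<and>
         integrable (lebesgue_on {0<..<T}) (\<lambda>t. norm (u t) powr p)}"

definition bochner_norm :: "real \<Rightarrow> real \<Rightarrow> (real \<Rightarrow> 'b::real_normed_vector) \<Rightarrow> real" where
  "bochner_norm p T u = (LINT t|lebesgue_on {0<..<T}. norm (u t) powr p) powr (1 / p)"

definition cont_domain :: "real \<Rightarrow> real \<Rightarrow> (real \<Rightarrow> 'b::real_normed_vector) set" where
  "cont_domain p T = {\<theta>. continuous_on {0..T} \<theta>} \<inter> bochner_space p T"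

definition pointwise_domain :: "real \<Rightarrow> real \<Rightarrow> real \<Rightarrow> 'b::real_normed_vector set" where
  "pointwise_domain p T t = {\<theta> t | \<theta>. \<theta> \<in> cont_domain p T}"

definition reflexive_space :: "'a::real_normed_vector itself \<Rightarrow> bool" where
  "reflexive_space _ \<longleftrightarrow>
     (\<forall>\<Phi> :: ('a \<Rightarrow>\<^sub>L real) \<Rightarrow>\<^sub>L real. \<exists>x. \<forall>f. blinfun_apply \<Phi> f = blinfun_apply f x)"

definition compact_linear :: "('a::real_normed_vector \<Rightarrow> 'b::real_normed_vector) \<Rightarrow> bool" where
  "compact_linear K \<longleftrightarrow> linear K \<and> (\<forall>B. bounded B \<longrightarrow> compact (closure (K ` B)))"

definition weakly_converges :: "(nat \<Rightarrow> 'a::real_normed_vector) \<Rightarrow> 'a \<Rightarrow> bool" where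
  "weakly_converges s l \<longleftrightarrow>
     (\<forall>f :: 'a \<Rightarrow>\<^sub>L real. (\<lambda>n. blinfun_apply f (s n)) \<longlonglongrightarrow> blinfun_apply f l)"

text \<open>Pre-compactness: the weak limit need not belong to the set.\<close>

definition weakly_seq_precompact :: "'a::real_normed_vector set \<Rightarrow> bool" where
  "weakly_seq_precompact A \<longleftrightarrow>
     (\<forall>s :: nat \<Rightarrow> 'a. (\<forall>n. s n \<in> A) \<longrightarrow>
        (\<exists>l \<phi>. strict_mono (\<phi> :: nat \<Rightarrow> nat) \<and> weakly_converges (s \<circ> \<phi>) l))"

definition proper_fun :: "('a \<Rightarrow> ennreal) \<Rightarrow> bool" where
  "proper_fun \<Omega> \<longleftrightarrow> (\<exists>x. \<Omega> x < \<infinity>)"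

text \<open>\<^const>\<open>convex_on\<close> covers real-valued functions only. In \<^typ>\<open>ennreal\<close>, \<open>0 * \<infinity> = 0\<close>, so
  including the end points of the unit interval is harmless.\<close>

definition convex_fun :: "('a::real_vector \<Rightarrow> ennreal) \<Rightarrow> bool" where
  "convex_fun \<Omega> \<longleftrightarrow> (\<forall>x y. \<forall>u\<in>{0..1::real}.
     \<Omega> ((1 - u) *\<^sub>R x + u *\<^sub>R y) \<le> ennreal (1 - u) * \<Omega> x + ennreal u * \<Omega> y)"

definition lower_semicont :: "('a::topological_space \<Rightarrow> ennreal) \<Rightarrow> bool" where
  "lower_semicont \<Omega> \<longleftrightarrow> (\<forall>x. \<Omega> x \<le> Liminf (nhds x) \<Omega>)"

definition effective_domain :: "('a \<Rightarrow> ennreal) \<Rightarrow> 'a set" where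
  "effective_domain \<Omega> = {x. \<Omega> x < \<infinity>}"

definition index_function :: "(real \<Rightarrow> real) \<Rightarrow> bool" where
  "index_function a \<longleftrightarrow>
     a \<in> {0..} \<rightarrow> {0..} \<and> strict_mono_on {0..} a \<and> continuous_on {0..} a \<and> a 0 = 0"

definition tikhonov ::
  "real \<Rightarrow> ('a \<Rightarrow> 'b::real_normed_vector) \<Rightarrow> 'b \<Rightarrow> real \<Rightarrow> ('a \<Rightarrow> ennreal) \<Rightarrow> 'a \<Rightarrow> ennreal" where
  "tikhonov r G z a \<Omega> x = ennreal (1 / r * norm (G x - z) powr r) + ennreal a * \<Omega> x"

text \<open>
  The minimal value of \<open>\<Omega>\<close> may be \<open>\<infinity>\<close>, and then every solution is minimizing. In that degenerate case
  minimizers of the Tikhonov functionals need not have any weakly convergent subsequence, even for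
  exact data.
\<close>

definition minimizing_solution :: "('a \<Rightarrow> 'b) \<Rightarrow> 'b \<Rightarrow> ('a \<Rightarrow> ennreal) \<Rightarrow> 'a \<Rightarrow> bool" where
  "minimizing_solution G z \<Omega> x \<longleftrightarrow> is_arg_min \<Omega> (\<lambda>x. G x = z) x"

definition temporal_pointwise ::
  "(real \<Rightarrow> 'b::real_normed_vector \<Rightarrow>\<^sub>L 'b) \<Rightarrow> ('a \<Rightarrow> 'b) \<Rightarrow> real \<Rightarrow> 'a \<Rightarrow> 'b" where
  "temporal_pointwise S K t x = blinfun_apply (S t) (K x)"

definition temporal_operator ::
  "(real \<Rightarrow> 'b::real_normed_vector \<Rightarrow>\<^sub>L 'b) \<Rightarrow> ('a \<Rightarrow> 'b) \<Rightarrow> (real \<Rightarrow> 'a) \<Rightarrow> real \<Rightarrow> 'b" where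
  "temporal_operator S K \<theta> t = temporal_pointwise S K t (\<theta> t)"

end

theory Submission
  imports Defs
begin

text \<open>
  Fix a time \<open>t\<close>. Constant functions are continuous and belong to \<open>L\<^sup>p\<close>, so the pointwise domain is
  the whole space, and \<open>F\<^sub>t = S(t) K\<close> is a bounded linear operator on it. The existence of minimizers
  and the convergence of regularized solutions then are statements about linear Tikhonov
  regularization at fixed \<open>t\<close>; what links different times is only the noise bound.

  Both statements rest on compactness and weak lower semicontinuity. Sublevel sets of the penalty are
  weakly sequentially precompact by assumption. A function with closed convex sublevel sets is weakly
  sequentially lower semicontinuous because closed convex sets are weakly sequentially closed
  (\<open>weakly_converges_closed_convex\<close>). This applies to the penalty and to the residual. Separating a
  point from a closed convex set in an arbitrary normed space takes a Hahn--Banach argument, done here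
  through the Mazur--Orlicz theorem (\<open>mazur_orlicz\<close>), which follows from the fact that minimal
  sublinear functionals are linear.

  The noise bound controls the \<open>L\<^sup>q\<close> norm over time, whereas the convergence proof at time \<open>t\<close> needs
  \<open>norm (y t - y\<delta> (\<delta> n) t) powr r / \<alpha> t (\<delta> n)\<close> to tend to zero. Fatou's lemma bridges the gap: for
  almost every \<open>t\<close> there is a subsequence along which \<open>norm (y t - y\<delta> (\<delta> n) t)\<close> is at most a constant
  times \<open>\<delta> n\<close> (\<open>bochner_norm_less_imp_AE_subseq\<close>), so that the assumption on
  \<open>\<delta> powr r / \<alpha> t \<delta>\<close> applies along it. Since the conclusion asks only for a convergent
  subsequence, passing to this one does no harm.
\<close>

section \<open>The Mazur--Orlicz theorem\<close>

definition sublinear :: "('a::real_vector \<Rightarrow> real) \<Rightarrow> bool" where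
  "sublinear q \<longleftrightarrow> (\<forall>x y. q (x + y) \<le> q x + q y) \<and> (\<forall>c x. 0 < c \<longrightarrow> q (c *\<^sub>R x) = c * q x)"

lemma sublinear_add: "sublinear q \<Longrightarrow> q (x + y) \<le> q x + q y"
  and sublinear_scale: "sublinear q \<Longrightarrow> 0 < c \<Longrightarrow> q (c *\<^sub>R x) = c * q x"
  by (auto simp: sublinear_def)

lemma sublinear_0:
  assumes "sublinear q"
  shows "q 0 = 0"
  using sublinear_scale[OF assms, of 2 0] by simp

lemma sublinear_scale_nonneg: "sublinear q \<Longrightarrow> 0 \<le> c \<Longrightarrow> q (c *\<^sub>R x) = c * q x"
  using sublinear_scale[of q c x] sublinear_0[of q] by (cases "c = 0") auto

lemma sublinear_minus: "sublinear q \<Longrightarrow> - q (- x) \<le> q x"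
  using sublinear_add[of q x "- x"] sublinear_0[of q] by simp

text \<open>
  One inequality for the scaling law suffices: applied to \<open>1 / c\<close> and \<open>c x\<close> it gives the other one.
\<close>

lemma sublinearI:
  assumes add: "\<And>x y. q (x + y) \<le> q x + q y"
    and scale: "\<And>c x. 0 < c \<Longrightarrow> c * q x \<le> q (c *\<^sub>R x)"
  shows "sublinear q"
proof -
  have "q (c *\<^sub>R x) = c * q x" if c: "0 < c" for c x
  proof (rule antisym)
    have "inverse c * q (c *\<^sub>R x) \<le> q x"
      using scale[of "inverse c" "c *\<^sub>R x"] c by simp
    then show "q (c *\<^sub>R x) \<le> c * q x"
      using c by (simp add: field_simps)
  qed (rule scale[OF c])
  with add show ?thesis
    by (simp add: sublinear_def)
qed

lemma sublinear_norm: "sublinear norm"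
  by (rule sublinearI) (auto intro: norm_triangle_ineq)

text \<open>
  If \<open>D\<close> is convex and nonempty and \<open>d \<le> q w\<close> on \<open>D\<close>, this is the largest sublinear functional
  \<open>g\<close> below \<open>q\<close> such that \<open>g (- w) \<le> - d\<close> for all \<open>w \<in> D\<close>: these conditions force
  \<open>g v \<le> g (v + s w) + s g (- w) \<le> q (v + s w) - s d\<close>. Every linear functional below it is at least
  \<open>d\<close> on \<open>D\<close>. General convex sets give the theorem, and singletons \<open>D = {v}\<close> show that minimal
  sublinear functionals are odd.
\<close>

definition lowered :: "('a::real_vector \<Rightarrow> real) \<Rightarrow> 'a set \<Rightarrow> real \<Rightarrow> 'a \<Rightarrow> real" where
  "lowered q D d v = (INF (s, w)\<in>{0..} \<times> D. q (v + s *\<^sub>R w) - s * d)"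

context
  fixes q :: "'a::real_vector \<Rightarrow> real" and D d
  assumes q: "sublinear q" and D: "convex D" "D \<noteq> {}" and d: "\<And>w. w \<in> D \<Longrightarrow> d \<le> q w"
begin

lemma lowered_le: "lowered q D d v \<le> q (v + s *\<^sub>R w) - s * d" if "0 \<le> s" "w \<in> D"
proof -
  have "bdd_below ((\<lambda>(s, w). q (v + s *\<^sub>R w) - s * d) ` ({0..} \<times> D))"
  proof (rule bdd_belowI[of _ "- q (- v)"])
    fix z assume "z \<in> (\<lambda>(s, w). q (v + s *\<^sub>R w) - s * d) ` ({0..} \<times> D)"
    then obtain s w where sw: "0 \<le> s" "w \<in> D" and z: "z = q (v + s *\<^sub>R w) - s * d"
      by auto
    have "q (s *\<^sub>R w) \<le> q (- v) + q (v + s *\<^sub>R w)"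
      using sublinear_add[OF q, of "- v" "v + s *\<^sub>R w"] by simp
    moreover have "s * d \<le> q (s *\<^sub>R w)"
      using sw d[of w] by (simp add: sublinear_scale_nonneg[OF q] mult_left_mono)
    ultimately show "- q (- v) \<le> z"
      unfolding z by linarith
  qed
  from cINF_lower[OF this, of "(s, w)"] that show ?thesis
    by (simp add: lowered_def)
qed

lemma le_lowered: "b \<le> lowered q D d v" if "\<And>s w. 0 \<le> s \<Longrightarrow> w \<in> D \<Longrightarrow> b \<le> q (v + s *\<^sub>R w) - s * d"
  unfolding lowered_def by (rule cINF_greatest) (use D that in auto)

lemma lowered_le_self: "lowered q D d v \<le> q v"
  using lowered_le[of 0] D by auto

lemma lowered_neg: "lowered q D d (- w) \<le> - d" if "w \<in> D"
  using lowered_le[of 1 w "- w"] that sublinear_0[OF q] by simp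

text \<open>
  Subadditivity is where convexity of \<open>D\<close> enters: two directions \<open>s w\<close> and \<open>s' w'\<close> add up to
  \<open>s + s'\<close> times a point of \<open>D\<close>.
\<close>

lemma sublinear_lowered: "sublinear (lowered q D d)"
proof (rule sublinearI)
  let ?L = "lowered q D d"
  fix x y
  have main: "?L (x + y) \<le> (q (x + s *\<^sub>R w) - s * d) + (q (y + s' *\<^sub>R w') - s' * d)"
    if sw: "0 \<le> s" "w \<in> D" "0 \<le> s'" "w' \<in> D" for s s' :: real and w w'
  proof -
    obtain w'' where w'': "w'' \<in> D" "(s + s') *\<^sub>R w'' = s *\<^sub>R w + s' *\<^sub>R w'"
    proof (cases "s + s' = 0")
      case True
      then have "s = 0" "s' = 0" using sw by auto
      with sw that show ?thesis by auto
    next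
      case False
      with sw have pos: "0 < s + s'" by auto
      have "(s / (s + s')) *\<^sub>R w + (s' / (s + s')) *\<^sub>R w' \<in> D"
        using pos sw by (intro convexD[OF D(1)]) (auto simp flip: add_divide_distrib)
      with pos show ?thesis
        by (intro that) (auto simp: scaleR_add_right)
    qed
    have "?L (x + y) \<le> q ((x + y) + (s + s') *\<^sub>R w'') - (s + s') * d"
      using sw w'' by (intro lowered_le) auto
    also have "(x + y) + (s + s') *\<^sub>R w'' = (x + s *\<^sub>R w) + (y + s' *\<^sub>R w')"
      by (simp add: w'')
    also have "q \<dots> \<le> q (x + s *\<^sub>R w) + q (y + s' *\<^sub>R w')"
      by (rule sublinear_add[OF q])
    finally show ?thesis by (simp add: algebra_simps)
  qed
  have "?L (x + y) - ?L y \<le> ?L x"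
  proof (rule le_lowered)
    fix s :: real and w assume sw: "0 \<le> s" "w \<in> D"
    have "?L (x + y) - (q (x + s *\<^sub>R w) - s * d) \<le> ?L y"
      by (rule le_lowered) (use main[OF sw] in force)
    then show "?L (x + y) - ?L y \<le> q (x + s *\<^sub>R w) - s * d"
      by linarith
  qed
  then show "?L (x + y) \<le> ?L x + ?L y"
    by linarith
next
  let ?L = "lowered q D d"
  fix c :: real and x assume c: "0 < c"
  show "c * ?L x \<le> ?L (c *\<^sub>R x)"
  proof (rule le_lowered)
    fix s :: real and w assume sw: "0 \<le> s" "w \<in> D"
    have "?L x \<le> q (x + (s / c) *\<^sub>R w) - (s / c) * d"
      using sw c by (intro lowered_le) auto
    then have "c * ?L x \<le> c * q (x + (s / c) *\<^sub>R w) - s * d"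
      using c by (simp add: field_simps)
    also have "c * q (x + (s / c) *\<^sub>R w) = q (c *\<^sub>R (x + (s / c) *\<^sub>R w))"
      using sublinear_scale[OF q c] by simp
    also have "c *\<^sub>R (x + (s / c) *\<^sub>R w) = c *\<^sub>R x + s *\<^sub>R w"
      using c by (simp add: scaleR_add_right)
    finally show "c * ?L x \<le> q (c *\<^sub>R x + s *\<^sub>R w) - s * d" .
  qed
qed

end

text \<open>
  Zorn's lemma for the reversed pointwise order. The infimum of a chain is finite because every
  sublinear \<open>g \<le> q\<close> satisfies \<open>g x \<ge> - g (- x) \<ge> - q (- x)\<close>, and it is subadditive because any two
  members of a chain dominate a common member.
\<close>

lemma minimal_sublinear_ex:
  assumes q: "sublinear q"
  shows "\<exists>f. sublinear f \<and> f \<le> q \<and> (\<forall>g. sublinear g \<longrightarrow> g \<le> f \<longrightarrow> g = f)"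
proof -
  let ?A = "{g. sublinear g \<and> g \<le> q}"
  have "\<exists>m\<in>?A. \<forall>a\<in>?A. a \<le> m \<longrightarrow> a = m"
  proof (rule predicate_Zorn[of ?A "\<lambda>f g. g \<le> f"])
    show "partial_order_on ?A (relation_of (\<lambda>f g. g \<le> f) ?A)"
      by (rule partial_order_on_relation_ofI) auto
    fix C assume "C \<in> Chains (relation_of (\<lambda>f g. g \<le> f) ?A)"
    then have sub: "\<And>g. g \<in> C \<Longrightarrow> sublinear g \<and> g \<le> q"
      and chain: "\<And>g h. g \<in> C \<Longrightarrow> h \<in> C \<Longrightarrow> g \<le> h \<or> h \<le> g"
      by (auto simp: Chains_def relation_of_def)
    show "\<exists>u\<in>?A. \<forall>a\<in>C. u \<le> a"
    proof (cases "C = {}")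
      case True
      with q show ?thesis by auto
    next
      case False
      define u where "u = (\<lambda>x. INF g\<in>C. g x)"
      have u_le: "u x \<le> g x" if "g \<in> C" for g x
        unfolding u_def
      proof (rule cINF_lower[OF _ that])
        show "bdd_below ((\<lambda>g. g x) ` C)"
        proof (rule bdd_belowI[of _ "- q (- x)"], safe)
          fix g assume "g \<in> C"
          then show "- q (- x) \<le> g x"
            using sub[of g] sublinear_minus[of g x] le_funD[of g q "- x"] by auto
        qed
      qed
      have le_u: "b \<le> u x" if "\<And>g. g \<in> C \<Longrightarrow> b \<le> g x" for b x
        unfolding u_def by (rule cINF_greatest[OF False]) (rule that)
      have "sublinear u"
      proof (rule sublinearI)
        fix x y
        have main: "u (x + y) \<le> g x + h y" if gh: "g \<in> C" "h \<in> C" for g h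
        proof -
          obtain k where k: "k \<in> C" "k \<le> g" "k \<le> h"
            using chain[OF gh] gh by auto
          have "u (x + y) \<le> k (x + y)" by (rule u_le[OF k(1)])
          also have "\<dots> \<le> k x + k y" using sub[OF k(1)] by (simp add: sublinear_add)
          also have "\<dots> \<le> g x + h y" using k by (intro add_mono) (auto dest: le_funD)
          finally show ?thesis .
        qed
        have "u (x + y) - u y \<le> u x"
        proof (rule le_u)
          fix g assume g: "g \<in> C"
          have "u (x + y) - g x \<le> u y"
            by (rule le_u) (use main[OF g] in force)
          then show "u (x + y) - u y \<le> g x" by linarith
        qed
        then show "u (x + y) \<le> u x + u y" by linarith
      next
        fix c :: real and x assume c: "0 < c"
        show "c * u x \<le> u (c *\<^sub>R x)"
        proof (rule le_u)
          fix g assume g: "g \<in> C"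
          have "c * u x \<le> c * g x" using u_le[OF g] c by simp
          then show "c * u x \<le> g (c *\<^sub>R x)"
            using sub[OF g] c by (simp add: sublinear_scale)
        qed
      qed
      moreover obtain g where "g \<in> C" using False by auto
      then have "u \<le> q"
        using u_le[of g] sub[of g] by (auto simp: le_fun_def intro: order_trans)
      ultimately show ?thesis
        using u_le by (auto simp: le_fun_def)
    qed
  qed
  then show ?thesis
    by (auto intro: order_trans)
qed

text \<open>
  Lowering \<open>f\<close> at a single point \<open>v\<close> to make it at most \<open>- f v\<close> at \<open>- v\<close> cannot change a minimal
  \<open>f\<close>. So \<open>f\<close> is odd, and an odd sublinear functional is linear.
\<close>

lemma minimal_sublinear_linear:
  assumes f: "sublinear f" and min: "\<And>g. sublinear g \<Longrightarrow> g \<le> f \<Longrightarrow> g = f"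
  shows "linear f"
proof -
  have odd: "f (- v) = - f v" for v
  proof (rule antisym)
    let ?g = "lowered f {v} (f v)"
    have "?g = f"
    proof (rule min)
      show "sublinear ?g" by (rule sublinear_lowered[OF f]) auto
      show "?g \<le> f" by (intro le_funI lowered_le_self[OF f]) auto
    qed
    moreover have "?g (- v) \<le> - f v"
      by (rule lowered_neg[OF f]) auto
    ultimately show "f (- v) \<le> - f v" by simp
    show "- f v \<le> f (- v)" using sublinear_minus[OF f, of v] by linarith
  qed
  have add: "f (x + y) = f x + f y" for x y
    using sublinear_add[OF f, of x y] sublinear_add[OF f, of "- x" "- y"] odd[of "x + y"] odd[of x] odd[of y]
    by simp
  show ?thesis
  proof (rule linearI)
    fix c x
    show "f (c *\<^sub>R x) = c *\<^sub>R f x"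
      using sublinear_scale_nonneg[OF f, of c x] sublinear_scale_nonneg[OF f, of "- c" x] odd[of "c *\<^sub>R x"]
      by (cases "0 \<le> c") auto
  qed (rule add)
qed

text \<open>
  This form of the Hahn--Banach theorem combines domination and separation, so that no functional
  ever has to be extended from a subspace.
\<close>

theorem mazur_orlicz:
  assumes q: "sublinear q" and D: "convex D" "D \<noteq> {}" and d: "\<And>w. w \<in> D \<Longrightarrow> d \<le> q w"
  obtains f where "linear f" "\<And>v. f v \<le> q v" "\<And>w. w \<in> D \<Longrightarrow> d \<le> f w"
proof -
  let ?L = "lowered q D d"
  obtain f where f: "sublinear f" "f \<le> ?L" "\<And>g. sublinear g \<Longrightarrow> g \<le> f \<Longrightarrow> g = f"
    using minimal_sublinear_ex[OF sublinear_lowered[OF q D d]] by blast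
  have lin: "linear f" by (rule minimal_sublinear_linear) (use f in auto)
  show thesis
  proof (rule that[OF lin])
    show "f v \<le> q v" for v
      using le_funD[OF f(2), of v] lowered_le_self[OF q D d, of v] by linarith
    show "d \<le> f w" if "w \<in> D" for w
      using le_funD[OF f(2), of "- w"] lowered_neg[OF q D d, of w] linear_neg[OF lin, of w] that
      by auto
  qed
qed

section \<open>Weak lower semicontinuity\<close>

text \<open>
  Mazur's theorem. If \<open>l\<close> had positive distance \<open>d\<close> to \<open>A\<close>, then the norm would be at least \<open>d\<close> on
  the convex set \<open>l - A\<close>, and a linear functional dominated by the norm would keep \<open>l\<close> and all the
  \<open>s n\<close> apart by \<open>d\<close>.
\<close>

theorem weakly_converges_closed_convex:
  fixes A :: "'a::real_normed_vector set"
  assumes A: "closed A" "convex A" and s: "\<And>n. s n \<in> A" and wk: "weakly_converges s l"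
  shows "l \<in> A"
proof (rule ccontr)
  assume l: "l \<notin> A"
  let ?d = "infdist l A"
  have "A \<noteq> {}" using s by auto
  then have pos: "0 < ?d"
    using in_closed_iff_infdist_zero[OF A(1), of l] infdist_nonneg[of l A] l
    by (simp add: order_less_le)
  let ?D = "(\<lambda>a. l - a) ` A"
  have "convex ?D"
    using convex_affinity[OF A(2), of l "- 1"] by simp
  moreover have "?D \<noteq> {}" using \<open>A \<noteq> {}\<close> by auto
  moreover have "?d \<le> norm w" if "w \<in> ?D" for w
    using that infdist_le[of _ A l] by (auto simp: dist_norm)
  ultimately obtain f where f: "linear f" "\<And>v. f v \<le> norm v" "\<And>w. w \<in> ?D \<Longrightarrow> ?d \<le> f w"
    using mazur_orlicz[OF sublinear_norm] by blast
  have bl: "bounded_linear f"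
  proof (rule bounded_linear_intro[of _ 1])
    fix v
    have "- f v \<le> norm v" using f(2)[of "- v"] by (simp add: linear_neg[OF f(1)])
    then show "norm (f v) \<le> norm v * 1" using f(2)[of v] by auto
  qed (simp_all add: linear_add[OF f(1)] linear_cmul[OF f(1)])
  have "(\<lambda>n. f (s n)) \<longlonglongrightarrow> f l"
    using wk[unfolded weakly_converges_def, rule_format, of "Blinfun f"]
    by (simp add: bounded_linear_Blinfun_apply[OF bl])
  then have "(\<lambda>n. f l - f (s n)) \<longlonglongrightarrow> f l - f l"
    by (intro tendsto_intros)
  moreover have "?d \<le> f l - f (s n)" for n
    using f(3)[of "l - s n"] s by (simp add: linear_diff[OF f(1)])
  ultimately have "?d \<le> 0"
    by (intro LIMSEQ_le_const) auto
  with pos show False by simp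
qed

text \<open>
  If \<open>\<phi> (s n) \<le> c\<close> holds infinitely often, then the sublevel set at \<open>c\<close> contains a subsequence of
  \<open>s\<close> and, being weakly sequentially closed, also \<open>l\<close>.
\<close>

lemma weakly_converges_le_liminf:
  fixes \<phi> :: "'a::real_normed_vector \<Rightarrow> ennreal"
  assumes closed: "\<And>c. closed {x. \<phi> x \<le> c}" and convex: "\<And>c. convex {x. \<phi> x \<le> c}"
    and wk: "weakly_converges s l"
  shows "\<phi> l \<le> liminf (\<lambda>n. \<phi> (s n))"
  unfolding le_Liminf_iff
proof (intro allI impI, rule ccontr)
  fix c assume c: "c < \<phi> l" and "\<not> (\<forall>\<^sub>F n in sequentially. c < \<phi> (s n))"
  then have "infinite {n. \<phi> (s n) \<le> c}"
    by (simp add: not_eventually not_less frequently_cofinite flip: cofinite_eq_sequentially)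
  then obtain r :: "nat \<Rightarrow> nat" where r: "strict_mono r" "\<And>n. \<phi> (s (r n)) \<le> c"
    using infinite_enumerate by blast
  have "weakly_converges (s \<circ> r) l"
    using wk LIMSEQ_subseq_LIMSEQ[OF _ r(1)] by (auto simp: weakly_converges_def o_def)
  from weakly_converges_closed_convex[OF closed[of c] convex[of c] _ this] r(2)
  have "\<phi> l \<le> c" by simp
  with c show False by simp
qed

lemma closed_sublevel_lower_semicont:
  assumes "lower_semicont \<Omega>"
  shows "closed {x. \<Omega> x \<le> c}"
proof -
  have "open {x. c < \<Omega> x}"
  proof (subst open_subopen, safe)
    fix x assume "c < \<Omega> x"
    also have "\<Omega> x \<le> Liminf (nhds x) \<Omega>" using assms by (simp add: lower_semicont_def)
    finally have "eventually (\<lambda>x. c < \<Omega> x) (nhds x)" by (rule less_LiminfD)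
    then show "\<exists>U. open U \<and> x \<in> U \<and> U \<subseteq> {x. c < \<Omega> x}"
      by (auto simp: eventually_nhds)
  qed
  moreover have "{x. c < \<Omega> x} = - {x. \<Omega> x \<le> c}" by auto
  ultimately show ?thesis by (simp add: closed_def)
qed

lemma convex_sublevel_convex_fun:
  assumes "convex_fun \<Omega>"
  shows "convex {x. \<Omega> x \<le> c}"
  unfolding convex_alt
proof safe
  fix x y and u :: real
  assume *: "\<Omega> x \<le> c" "\<Omega> y \<le> c" "0 \<le> u" "u \<le> 1"
  have "\<Omega> ((1 - u) *\<^sub>R x + u *\<^sub>R y) \<le> ennreal (1 - u) * \<Omega> x + ennreal u * \<Omega> y"
    using assms * by (simp add: convex_fun_def)
  also have "\<dots> \<le> ennreal (1 - u) * c + ennreal u * c"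
    using * by (intro add_mono mult_left_mono) auto
  also have "\<dots> = (ennreal (1 - u) + ennreal u) * c"
    by (simp add: distrib_right)
  also have "ennreal (1 - u) + ennreal u = 1"
    using * by (simp flip: ennreal_plus)
  finally show "\<Omega> ((1 - u) *\<^sub>R x + u *\<^sub>R y) \<le> c" by simp
qed

text \<open>
  Used with \<open>h\<close> a multiple of a power and with \<open>h\<close> the identity. A monotone function of the convex
  function \<open>x \<mapsto> norm (G x - z)\<close> is quasi-convex.
\<close>

lemma residual_le_liminf:
  fixes G :: "'a::real_normed_vector \<Rightarrow> 'b::real_normed_vector" and h :: "real \<Rightarrow> real"
  assumes G: "bounded_linear G" and h: "continuous_on {0..} h" "mono_on {0..} h"
    and wk: "weakly_converges s l"
  shows "ennreal (h (norm (G l - z))) \<le> liminf (\<lambda>n. ennreal (h (norm (G (s n) - z))))"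
proof (rule weakly_converges_le_liminf[OF _ _ wk])
  interpret G: bounded_linear G by (fact G)
  fix c
  have "continuous_on UNIV (\<lambda>x. h (norm (G x - z)))"
    by (rule continuous_on_compose2[OF h(1)])
      (auto intro!: continuous_intros G.continuous_on)
  then show "closed {x. ennreal (h (norm (G x - z))) \<le> c}"
    by (intro closed_Collect_le continuous_on_ennreal continuous_on_const)
  show "convex {x. ennreal (h (norm (G x - z))) \<le> c}"
    unfolding convex_alt
  proof safe
    fix x y and u :: real
    assume xy: "ennreal (h (norm (G x - z))) \<le> c" "ennreal (h (norm (G y - z))) \<le> c"
      and u: "0 \<le> u" "u \<le> 1"
    let ?m = "max (norm (G x - z)) (norm (G y - z))"
    have "G ((1 - u) *\<^sub>R x + u *\<^sub>R y) - z = (1 - u) *\<^sub>R (G x - z) + u *\<^sub>R (G y - z)"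
      unfolding G.add G.scaleR by (simp add: algebra_simps)
    also have "norm \<dots> \<le> (1 - u) * norm (G x - z) + u * norm (G y - z)"
      using u by (intro norm_triangle_le) simp
    also have "\<dots> \<le> (1 - u) * ?m + u * ?m"
      using u by (intro add_mono mult_left_mono) auto
    finally have "norm (G ((1 - u) *\<^sub>R x + u *\<^sub>R y) - z) \<le> ?m"
      by (simp add: algebra_simps)
    then have "h (norm (G ((1 - u) *\<^sub>R x + u *\<^sub>R y) - z)) \<le> h ?m"
      by (intro mono_onD[OF h(2)]) (auto simp: le_max_iff_disj)
    then have "ennreal (h (norm (G ((1 - u) *\<^sub>R x + u *\<^sub>R y) - z))) \<le> ennreal (h ?m)"
      by (rule ennreal_leI)
    also have "\<dots> \<le> c" using xy by (simp add: max_def)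
    finally show "ennreal (h (norm (G ((1 - u) *\<^sub>R x + u *\<^sub>R y) - z))) \<le> c" .
  qed
qed

lemma ennreal_liminf_add_le:
  fixes f g :: "nat \<Rightarrow> ennreal"
  shows "liminf f + liminf g \<le> liminf (\<lambda>n. f n + g n)"
proof -
  have inc: "incseq (\<lambda>n. INF i\<in>{n..}. h i)" for h :: "nat \<Rightarrow> ennreal"
    by (intro incseq_SucI INF_superset_mono) auto
  have "liminf f + liminf g = (SUP n. (INF i\<in>{n..}. f i) + (INF i\<in>{n..}. g i))"
    unfolding liminf_SUP_INF by (rule ennreal_SUP_add[OF inc inc, symmetric])
  also have "\<dots> \<le> (SUP n. INF i\<in>{n..}. f i + g i)"
    by (intro SUP_mono' INF_greatest add_mono INF_lower)
  finally show ?thesis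
    unfolding liminf_SUP_INF .
qed

lemma ennreal_mult_le_imp_le_divide:
  assumes "0 < a" "ennreal a * X \<le> ennreal b"
  shows "X \<le> ennreal (b / a)"
proof (cases X)
  case (real x)
  then have "ennreal (a * x) \<le> ennreal b" using assms by (simp add: ennreal_mult')
  then show ?thesis
  proof (cases "x = 0")
    case False
    with real assms have "0 < a * x" by simp
    then have "a * x \<le> b" using \<open>ennreal (a * x) \<le> ennreal b\<close>
      by (metis ennreal_le_iff2 not_le)
    with real assms show ?thesis by (auto intro!: ennreal_leI simp: field_simps)
  qed (use real in simp)
next
  case top
  with assms show ?thesis by (simp add: ennreal_mult_top top_unique)
qed

section \<open>Tikhonov regularization\<close>

text \<open>
  The direct method. Along a minimizing sequence \<open>\<Omega>\<close> is bounded, so a subsequence converges weakly,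
  and both terms of the functional are weakly lower semicontinuous.
\<close>

lemma tikhonov_minimizer_ex:
  fixes G :: "'a::real_normed_vector \<Rightarrow> 'b::real_normed_vector"
  assumes G: "bounded_linear G" and r: "0 < r" and a: "0 < a"
    and \<Omega>: "proper_fun \<Omega>" "convex_fun \<Omega>" "lower_semicont \<Omega>"
    and pre: "\<And>c::real. weakly_seq_precompact {x. \<Omega> x \<le> ennreal c}"
  shows "\<exists>x. \<forall>u. tikhonov r G z a \<Omega> x \<le> tikhonov r G z a \<Omega> u"
proof -
  let ?J = "tikhonov r G z a \<Omega>"
  let ?m = "INF x. ?J x"
  obtain x0 where "\<Omega> x0 < \<infinity>" using \<Omega>(1) by (auto simp: proper_fun_def)
  then have "?J x0 < \<infinity>" by (auto simp: tikhonov_def ennreal_mult_less_top)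
  moreover have "?m \<le> ?J x0" by (rule INF_lower) simp
  ultimately have "?m < \<infinity>" by (rule order.strict_trans1[rotated])
  then obtain m where m: "0 \<le> m" "?m = ennreal m" by (cases ?m) auto
  have "\<exists>x. ?J x < ennreal (m + 1 / Suc n)" for n
  proof -
    have "?m < ennreal (m + 1 / Suc n)" unfolding m(2) using m(1) by (intro ennreal_lessI)
      (auto intro: add_nonneg_pos)
    then show ?thesis by (simp add: INF_less_iff)
  qed
  then obtain s where s: "\<And>n. ?J (s n) < ennreal (m + 1 / Suc n)" by metis
  have "\<Omega> (s n) \<le> ennreal ((m + 1) / a)" for n
  proof (rule ennreal_mult_le_imp_le_divide[OF a])
    have "ennreal a * \<Omega> (s n) \<le> ?J (s n)" by (simp add: tikhonov_def)
    also have "\<dots> \<le> ennreal (m + 1 / Suc n)" using s[of n] by simp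
    also have "\<dots> \<le> ennreal (m + 1)" by (intro ennreal_leI) simp
    finally show "ennreal a * \<Omega> (s n) \<le> ennreal (m + 1)" .
  qed
  then obtain l \<phi> where \<phi>: "strict_mono (\<phi> :: nat \<Rightarrow> nat)" and l: "weakly_converges (s \<circ> \<phi>) l"
    using pre[of "(m + 1) / a"] unfolding weakly_seq_precompact_def by blast
  let ?A = "\<lambda>x. ennreal (1 / r * norm (G x - z) powr r)"
  have A: "?A l \<le> liminf (\<lambda>n. ?A ((s \<circ> \<phi>) n))"
    by (rule residual_le_liminf[OF G _ _ l, where h = "\<lambda>t. 1 / r * t powr r"])
      (use r in \<open>auto intro!: continuous_on_divide continuous_on_powr' continuous_on_const
         continuous_on_id mono_onI divide_right_mono powr_mono2\<close>)
  have "\<Omega> l \<le> liminf (\<lambda>n. \<Omega> ((s \<circ> \<phi>) n))"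
    by (rule weakly_converges_le_liminf[OF closed_sublevel_lower_semicont[OF \<Omega>(3)]
          convex_sublevel_convex_fun[OF \<Omega>(2)] l])
  then have B: "ennreal a * \<Omega> l \<le> liminf (\<lambda>n. ennreal a * \<Omega> ((s \<circ> \<phi>) n))"
    using ennreal_continuous_on_cmult[of "ennreal a" UNIV "\<lambda>x. x"]
    by (subst Liminf_compose_continuous_mono[where f = "\<lambda>x. ennreal a * x"])
      (auto intro!: monoI intro: mult_left_mono)
  have "?J l \<le> liminf (\<lambda>n. ?J ((s \<circ> \<phi>) n))"
    unfolding tikhonov_def by (rule order_trans[OF add_mono[OF A B] ennreal_liminf_add_le])
  also have "\<dots> \<le> liminf (\<lambda>n. ennreal (m + 1 / Suc (\<phi> n)))"
    using s by (intro Liminf_mono always_eventually) (auto intro: less_imp_le)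
  also have "\<dots> = ?m"
  proof -
    have "(\<lambda>n. m + 1 / Suc n) \<longlonglongrightarrow> m + 0"
      by (intro tendsto_intros LIMSEQ_inverse_real_of_nat[unfolded inverse_eq_divide])
    from LIMSEQ_subseq_LIMSEQ[OF this \<phi>]
    have "(\<lambda>n. ennreal (m + 1 / Suc (\<phi> n))) \<longlonglongrightarrow> ennreal m"
      by (intro tendsto_ennrealI) (simp add: o_def)
    then show ?thesis unfolding m(2) by (intro lim_imp_Liminf) auto
  qed
  finally have "?J l \<le> ?m" .
  then show ?thesis
    by (metis INF_lower UNIV_I order_trans)
qed

text \<open>
  The noise enters only through \<open>e n = norm (g - z n) powr r / a n\<close>. Comparing the minimizer with an
  exact solution \<open>u\<close> gives \<open>\<Omega> (x n) \<le> e n / r + \<Omega> u\<close> and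
  \<open>norm (G (x n) - z n) powr r \<le> (e n + r * \<Omega> u) * a n\<close>. The first bound with \<open>u = x0\<close> yields weak
  compactness, the second one shows that weak limits solve the equation, and then the first one with
  arbitrary \<open>u\<close> shows that they minimize \<open>\<Omega>\<close> among the solutions.
\<close>

lemma tikhonov_minimizers_subseq_converge:
  fixes G :: "'a::real_normed_vector \<Rightarrow> 'b::real_normed_vector"
  assumes G: "bounded_linear G" and r: "0 < r" and a: "\<And>n. 0 < a n"
    and \<Omega>: "convex_fun \<Omega>" "lower_semicont \<Omega>"
    and pre: "\<And>c::real. weakly_seq_precompact {x. \<Omega> x \<le> ennreal c}"
    and a0: "a \<longlonglongrightarrow> 0" and e0: "(\<lambda>n. norm (g - z n) powr r / a n) \<longlonglongrightarrow> 0"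
    and sol: "G x0 = g" "\<Omega> x0 < \<infinity>"
    and x: "\<And>n u. tikhonov r G (z n) (a n) \<Omega> (x n) \<le> tikhonov r G (z n) (a n) \<Omega> u"
  shows "\<exists>\<phi> l. strict_mono (\<phi> :: nat \<Rightarrow> nat) \<and> weakly_converges (x \<circ> \<phi>) l \<and>
           minimizing_solution G g \<Omega> l"
proof -
  define e where "e = (\<lambda>n. norm (g - z n) powr r / a n)"
  have e: "e \<longlonglongrightarrow> 0" "norm (g - z n) powr r = e n * a n" for n
    using e0 a[of n] by (auto simp: e_def)
  have e_nonneg: "0 \<le> e n" for n using a[of n] by (simp add: e_def)
  have bounds: "\<Omega> (x n) \<le> ennreal (e n / r + \<omega>)" "norm (G (x n) - z n) powr r \<le> (e n + r * \<omega>) * a n"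
    if u: "G u = g" "\<Omega> u = ennreal \<omega>" "0 \<le> \<omega>" for u \<omega> n
  proof -
    have "ennreal (1 / r * norm (G (x n) - z n) powr r) + ennreal (a n) * \<Omega> (x n)
        \<le> ennreal (1 / r * (e n * a n)) + ennreal (a n) * ennreal \<omega>"
      using x[of n u] u by (simp add: tikhonov_def e(2))
    also have "\<dots> = ennreal (1 / r * (e n * a n) + a n * \<omega>)"
      using r a[of n] e_nonneg[of n] u by (subst ennreal_plus) (auto simp: ennreal_mult)
    finally have *: "ennreal (1 / r * norm (G (x n) - z n) powr r) + ennreal (a n) * \<Omega> (x n)
        \<le> ennreal (1 / r * (e n * a n) + a n * \<omega>)" .
    have "ennreal (a n) * \<Omega> (x n) \<le> ennreal (1 / r * (e n * a n) + a n * \<omega>)"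
      by (rule order_trans[OF _ *]) simp
    from ennreal_mult_le_imp_le_divide[OF a this]
    show "\<Omega> (x n) \<le> ennreal (e n / r + \<omega>)"
      using a[of n] by (simp add: add_divide_distrib)
    have "ennreal (1 / r * norm (G (x n) - z n) powr r) \<le> ennreal (1 / r * (e n * a n) + a n * \<omega>)"
      by (rule order_trans[OF _ *]) simp
    then have "1 / r * norm (G (x n) - z n) powr r \<le> 1 / r * (e n * a n) + a n * \<omega>"
      by (subst (asm) ennreal_le_iff) (use r a[of n] e_nonneg[of n] u in auto)
    then show "norm (G (x n) - z n) powr r \<le> (e n + r * \<omega>) * a n"
      using r by (simp add: field_simps)
  qed
  obtain \<omega> where \<omega>: "0 \<le> \<omega>" "\<Omega> x0 = ennreal \<omega>" using sol(2) by (cases "\<Omega> x0") auto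
  have "Bseq e" using e(1) by (intro convergent_imp_Bseq) (auto simp: convergent_def)
  then obtain B where B: "\<And>n. e n \<le> B" by (auto simp: Bseq_def abs_le_iff)
  have "\<Omega> (x n) \<le> ennreal (B / r + \<omega>)" for n
    using bounds(1)[OF sol(1) \<omega>(2,1), of n] B[of n] r
    by (elim order_trans) (auto intro!: ennreal_leI divide_right_mono)
  then obtain l \<phi> where \<phi>: "strict_mono (\<phi> :: nat \<Rightarrow> nat)" and l: "weakly_converges (x \<circ> \<phi>) l"
    using pre[of "B / r + \<omega>"] unfolding weakly_seq_precompact_def by blast
  have root: "f \<longlonglongrightarrow> 0" if "\<And>n. 0 \<le> f n" "(\<lambda>n. f n powr r) \<longlonglongrightarrow> 0" for f :: "nat \<Rightarrow> real"
  proof -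
    have "(\<lambda>n. (f n powr r) powr (1 / r)) \<longlonglongrightarrow> 0 powr (1 / r)"
      using that r by (intro tendsto_powr') auto
    then show ?thesis using that(1) r by (simp add: powr_powr)
  qed
  have "(\<lambda>n. e n * a n) \<longlonglongrightarrow> 0"
    using tendsto_mult[OF e(1) a0] by simp
  then have z: "(\<lambda>n. norm (g - z n)) \<longlonglongrightarrow> 0"
    by - (rule root, simp_all add: e(2))
  have "(\<lambda>n. (e n + r * \<omega>) * a n) \<longlonglongrightarrow> (0 + r * \<omega>) * 0"
    by (intro tendsto_intros e(1) a0)
  then have "(\<lambda>n. (e n + r * \<omega>) * a n) \<longlonglongrightarrow> 0" by simp
  then have "(\<lambda>n. norm (G (x n) - z n) powr r) \<longlonglongrightarrow> 0"
    by (rule tendsto_sandwich[OF _ _ tendsto_const, rotated 2])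
      (use bounds(2)[OF sol(1) \<omega>(2,1)] in auto)
  then have "(\<lambda>n. norm (G (x n) - z n)) \<longlonglongrightarrow> 0"
    by - (rule root, simp_all)
  then have "(\<lambda>n. norm (G (x n) - z n) + norm (g - z n)) \<longlonglongrightarrow> 0"
    using tendsto_add[OF _ z] by fastforce
  then have "(\<lambda>n. norm (G (x n) - g)) \<longlonglongrightarrow> 0"
    by (rule tendsto_sandwich[OF _ _ tendsto_const, rotated 2])
      (use norm_triangle_ineq4[of "G (x n) - z n" "g - z n" for n] in auto)
  from LIMSEQ_subseq_LIMSEQ[OF this \<phi>]
  have "(\<lambda>n. ennreal (norm (G ((x \<circ> \<phi>) n) - g))) \<longlonglongrightarrow> ennreal 0"
    by (intro tendsto_ennrealI) (simp add: o_def)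
  then have "liminf (\<lambda>n. ennreal (norm (G ((x \<circ> \<phi>) n) - g))) = 0"
    by (simp add: lim_imp_Liminf)
  moreover have "ennreal (norm (G l - g)) \<le> liminf (\<lambda>n. ennreal (norm (G ((x \<circ> \<phi>) n) - g)))"
    by (rule residual_le_liminf[OF G _ _ l, where h = "\<lambda>t. t"]) (auto intro: mono_onI)
  ultimately have Gl: "G l = g" by (simp add: ennreal_eq_0_iff)
  have "\<Omega> l \<le> \<Omega> u" if u: "G u = g" for u
  proof (cases "\<Omega> u")
    case (real \<eta>)
    have "\<Omega> l \<le> liminf (\<lambda>n. \<Omega> ((x \<circ> \<phi>) n))"
      by (rule weakly_converges_le_liminf[OF closed_sublevel_lower_semicont[OF \<Omega>(2)]
            convex_sublevel_convex_fun[OF \<Omega>(1)] l])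
    also have "\<dots> \<le> liminf (\<lambda>n. ennreal (e (\<phi> n) / r + \<eta>))"
      using bounds(1)[OF u real(2,1)] by (intro Liminf_mono always_eventually) auto
    also have "\<dots> = ennreal \<eta>"
    proof -
      have "(\<lambda>n. e (\<phi> n) / r + \<eta>) \<longlonglongrightarrow> 0 / r + \<eta>"
        using LIMSEQ_subseq_LIMSEQ[OF e(1) \<phi>] r by (intro tendsto_intros) (auto simp: o_def)
      then have "(\<lambda>n. ennreal (e (\<phi> n) / r + \<eta>)) \<longlonglongrightarrow> ennreal \<eta>"
        by (intro tendsto_ennrealI) simp
      then show ?thesis by (intro lim_imp_Liminf) auto
    qed
    finally show ?thesis using real by simp
  qed simp
  with Gl have "minimizing_solution G g \<Omega> l"
    by (auto simp: minimizing_solution_def is_arg_min_linorder)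
  with \<phi> l show ?thesis by blast
qed

section \<open>Pointwise bounds from bounds in the Bochner norm\<close>

text \<open>
  Changing all functions to 0 on the exceptional null set makes the convergence hold everywhere;
  completeness of \<open>M\<close> carries measurability of the changed limit back to \<open>g\<close>.
\<close>

lemma borel_measurable_AE_LIMSEQ:
  fixes f :: "nat \<Rightarrow> 'a \<Rightarrow> real"
  assumes M: "complete_measure M" and f: "\<And>n. f n \<in> borel_measurable M"
    and lim: "AE t in M. (\<lambda>n. f n t) \<longlonglongrightarrow> g t"
  shows "g \<in> borel_measurable M"
proof -
  interpret complete_measure M by (fact M)
  obtain N where N: "N \<in> null_sets M" "\<And>t. t \<in> space M - N \<Longrightarrow> (\<lambda>n. f n t) \<longlonglongrightarrow> g t"
    using AE_E3[OF lim] by blast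
  have [measurable]: "N \<in> sets M" using N by auto
  have h: "(\<lambda>t. if t \<in> N then 0 else g t) \<in> borel_measurable M" (is "?h \<in> _")
  proof (rule borel_measurable_LIMSEQ_metric)
    show "(\<lambda>t. if t \<in> N then 0 else f n t) \<in> borel_measurable M" for n
      using f[of n] by measurable
    show "(\<lambda>n. if t \<in> N then 0 else f n t) \<longlonglongrightarrow> (if t \<in> N then 0 else g t)" if "t \<in> space M" for t
      using N(2)[of t] that by auto
  qed
  show ?thesis
  proof (rule measurableI)
    fix B :: "real set" assume B: "B \<in> sets borel"
    show "g -` B \<inter> space M \<in> sets M"
    proof (rule in_sets_AE)
      show "?h -` B \<inter> space M \<in> sets M" using h B by (rule measurable_sets)
      show "AE t in M. t \<in> ?h -` B \<inter> space M \<longleftrightarrow> t \<in> g -` B \<inter> space M"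
        using AE_not_in[OF N(1)] by eventually_elim auto
    qed auto
  qed auto
qed

lemma complete_measure_lebesgue_on:
  assumes "S \<in> sets lebesgue"
  shows "complete_measure (lebesgue_on S)"
proof
  fix A B :: "'a set" assume BA: "B \<subseteq> A" and A: "A \<in> null_sets (lebesgue_on S)"
  then have "A \<in> null_sets lebesgue" "A \<subseteq> S"
    using assms by (auto simp: null_sets_restrict_space)
  with BA have "B \<in> sets lebesgue" "B \<subseteq> S"
    using completion.complete by blast+
  then show "B \<in> sets (lebesgue_on S)"
    using assms by (simp add: sets_restrict_space_iff)
qed

lemma strongly_measurable_norm:
  assumes "complete_measure M" "strongly_measurable M u"
  shows "(\<lambda>t. norm (u t)) \<in> borel_measurable M"
proof -
  obtain s where s: "\<And>n. simple_function M (s n)" "AE t in M. (\<lambda>n. s n t) \<longlonglongrightarrow> u t"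
    using assms(2) by (auto simp: strongly_measurable_def)
  show ?thesis
  proof (rule borel_measurable_AE_LIMSEQ[OF assms(1)])
    show "(\<lambda>t. norm (s n t)) \<in> borel_measurable M" for n
      using simple_function_compose1[OF s(1)[of n], of norm] by (rule borel_measurable_simple_function)
    show "AE t in M. (\<lambda>n. norm (s n t)) \<longlonglongrightarrow> norm (u t)"
      using s(2) by eventually_elim (rule tendsto_norm)
  qed
qed

lemma strongly_measurable_diff:
  assumes "strongly_measurable M u" "strongly_measurable M v"
  shows "strongly_measurable M (\<lambda>t. u t - v t)"
proof -
  obtain s where s: "\<And>n. simple_function M (s n)" "AE t in M. (\<lambda>n. s n t) \<longlonglongrightarrow> u t"
    using assms(1) by (auto simp: strongly_measurable_def)
  obtain s' where s': "\<And>n. simple_function M (s' n)" "AE t in M. (\<lambda>n. s' n t) \<longlonglongrightarrow> v t"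
    using assms(2) by (auto simp: strongly_measurable_def)
  have "simple_function M (\<lambda>t. s n t - s' n t)" for n
    using simple_function_compose2[OF s(1)[of n] s'(1)[of n], of "(-)"] .
  moreover have "AE t in M. (\<lambda>n. s n t - s' n t) \<longlonglongrightarrow> u t - v t"
    using s(2) s'(2) by eventually_elim (rule tendsto_diff)
  ultimately show ?thesis
    unfolding strongly_measurable_def by (intro exI[of _ "\<lambda>n t. s n t - s' n t"]) auto
qed

text \<open>
  This makes the \<open>L\<^sup>p\<close> norm of a difference meaningful: the integral of a function that is not
  integrable would be zero by convention, and a bound on it would carry no information.
\<close>

lemma bochner_space_diff:
  assumes p: "0 \<le> p" and u: "u \<in> bochner_space p T" and v: "v \<in> bochner_space p T"
  shows "(\<lambda>t. u t - v t) \<in> bochner_space p T"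
proof -
  let ?M = "lebesgue_on {0<..<T}"
  have sm: "strongly_measurable ?M (\<lambda>t. u t - v t)"
    using u v by (auto simp: bochner_space_def intro: strongly_measurable_diff)
  have "(\<lambda>t. norm (u t - v t)) \<in> borel_measurable ?M"
    by (intro strongly_measurable_norm[OF _ sm] complete_measure_lebesgue_on) auto
  then have meas: "(\<lambda>t. norm (u t - v t) powr p) \<in> borel_measurable ?M"
    by measurable
  have bound: "norm (u t - v t) powr p \<le> 2 powr p * (norm (u t) powr p + norm (v t) powr p)" for t
  proof -
    have "norm (u t - v t) powr p \<le> (2 * max (norm (u t)) (norm (v t))) powr p"
      using p norm_triangle_ineq4[of "u t" "v t"] by (intro powr_mono2) auto
    also have "\<dots> = 2 powr p * max (norm (u t)) (norm (v t)) powr p"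
      by (rule powr_mult)
    also have "\<dots> \<le> 2 powr p * (norm (u t) powr p + norm (v t) powr p)"
      by (intro mult_left_mono) (auto simp: max_def)
    finally show ?thesis .
  qed
  have "integrable ?M (\<lambda>t. 2 powr p * (norm (u t) powr p + norm (v t) powr p))"
    using u v by (auto simp: bochner_space_def)
  then have "integrable ?M (\<lambda>t. norm (u t - v t) powr p)"
    by (rule Bochner_Integration.integrable_bound[OF _ meas]) (use bound in \<open>auto intro!: AE_I2\<close>)
  with sm show ?thesis
    by (simp add: bochner_space_def)
qed

text \<open>
  By Fatou's lemma the lower limit of \<open>(norm (w n t) / \<delta> n) powr q\<close> has integral at most 1, so it is
  finite for almost every \<open>t\<close>. Convergence in \<open>L\<^sup>q\<close> says nothing about the whole sequence at a fixed
  \<open>t\<close>, so the subsequence depends on \<open>t\<close>.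
\<close>

lemma bochner_norm_less_imp_AE_subseq:
  fixes w :: "nat \<Rightarrow> real \<Rightarrow> 'b::real_normed_vector"
  assumes q: "0 < q" and \<delta>: "\<And>n. 0 < \<delta> n"
    and w: "\<And>n. w n \<in> bochner_space q T" and less: "\<And>n. bochner_norm q T (w n) < \<delta> n"
  shows "AE t in lebesgue_on {0<..<T}.
           \<exists>C \<phi>. strict_mono (\<phi> :: nat \<Rightarrow> nat) \<and> (\<forall>n. norm (w (\<phi> n) t) \<le> C * \<delta> (\<phi> n))"
proof -
  let ?M = "lebesgue_on {0<..<T}"
  let ?g = "\<lambda>n t. ennreal (norm (w n t) powr q / \<delta> n powr q)"
  have int: "integrable ?M (\<lambda>t. norm (w n t) powr q)" for n
    using w[of n] by (simp add: bochner_space_def)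
  then have meas [measurable]: "(\<lambda>t. norm (w n t) powr q) \<in> borel_measurable ?M" for n
    by (rule borel_measurable_integrable)
  have le1: "(\<integral>\<^sup>+ t. ?g n t \<partial>?M) \<le> 1" for n
  proof -
    let ?I = "LINT t|?M. norm (w n t) powr q"
    have "0 \<le> ?I" by simp
    then have "?I = (?I powr (1 / q)) powr q" using q by (simp add: powr_powr)
    also have "\<dots> \<le> \<delta> n powr q"
      using less[of n] q by (intro powr_mono2) (auto simp: bochner_norm_def)
    finally have "?I / \<delta> n powr q \<le> 1" using \<delta>[of n] by (simp add: field_simps)
    moreover have "(\<integral>\<^sup>+ t. ?g n t \<partial>?M) = ennreal (LINT t|?M. norm (w n t) powr q / \<delta> n powr q)"
      using int[of n] by (intro nn_integral_eq_integral) auto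
    ultimately show ?thesis by (simp add: ennreal_le_1)
  qed
  have "(\<integral>\<^sup>+ t. liminf (\<lambda>n. ?g n t) \<partial>?M) \<le> liminf (\<lambda>n. \<integral>\<^sup>+ t. ?g n t \<partial>?M)"
    by (rule nn_integral_liminf) measurable
  also have "\<dots> \<le> 1"
    using Liminf_mono[of "\<lambda>n. \<integral>\<^sup>+ t. ?g n t \<partial>?M" "\<lambda>_. 1" sequentially] le1
    by (simp add: Liminf_const)
  finally have "(\<integral>\<^sup>+ t. liminf (\<lambda>n. ?g n t) \<partial>?M) \<noteq> \<infinity>"
    by (auto simp: top_unique)
  then have "AE t in ?M. liminf (\<lambda>n. ?g n t) \<noteq> \<infinity>"
    by (intro nn_integral_PInf_AE) measurable
  then show ?thesis
  proof eventually_elim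
    case (elim t)
    then obtain c where c: "0 \<le> c" "liminf (\<lambda>n. ?g n t) = ennreal c"
      by (cases "liminf (\<lambda>n. ?g n t)") auto
    define C where "C = c + 1"
    have C: "0 \<le> C" "liminf (\<lambda>n. ?g n t) < ennreal C"
      using c by (auto simp: C_def ennreal_lessI)
    have "\<not> eventually (\<lambda>n. ennreal C \<le> ?g n t) sequentially"
      using C(2) Liminf_bounded[of "ennreal C" "\<lambda>n. ?g n t" sequentially] by auto
    then have "\<exists>\<^sub>F n in sequentially. ?g n t < ennreal C"
      by (simp add: frequently_def not_less)
    then have "infinite {n. ?g n t < ennreal C}"
      by (simp add: frequently_cofinite flip: cofinite_eq_sequentially)
    then obtain \<phi> :: "nat \<Rightarrow> nat" where \<phi>: "strict_mono \<phi>" "\<And>n. ?g (\<phi> n) t < ennreal C"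
      using infinite_enumerate by blast
    have "norm (w (\<phi> n) t) \<le> C powr (1 / q) * \<delta> (\<phi> n)" for n
    proof -
      have "norm (w (\<phi> n) t) powr q \<le> C * \<delta> (\<phi> n) powr q"
        using \<phi>(2)[of n] \<delta>[of "\<phi> n"] C(1) by (simp add: ennreal_less_iff field_simps)
      then have "(norm (w (\<phi> n) t) powr q) powr (1 / q) \<le> (C * \<delta> (\<phi> n) powr q) powr (1 / q)"
        using q by (intro powr_mono2) auto
      then show ?thesis
        using q \<delta>[of "\<phi> n"] by (simp add: powr_powr powr_mult)
    qed
    with \<phi>(1) show ?case by blast
  qed
qed

section \<open>Temporal regularization\<close>

lemma const_in_cont_domain: "(\<lambda>_. x) \<in> cont_domain p T"
proof -
  have "strongly_measurable (lebesgue_on {0<..<T}) (\<lambda>_. x)"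
    unfolding strongly_measurable_def by (intro exI[of _ "\<lambda>_ _. x"]) auto
  moreover have "finite_measure (lebesgue_on {0<..<T})"
    by (rule finite_measure_lebesgue_on) auto
  ultimately show ?thesis
    by (auto simp: cont_domain_def bochner_space_def intro: finite_measure.integrable_const)
qed

lemma pointwise_domain_eq_UNIV: "pointwise_domain p T t = UNIV"
proof (rule UNIV_eq_I[symmetric])
  fix x :: 'a
  show "x \<in> pointwise_domain p T t"
    using const_in_cont_domain[of x p T] by (auto simp: pointwise_domain_def intro!: exI[of _ "\<lambda>_. x"])
qed

lemma bounded_linear_compact_linear:
  assumes "compact_linear K"
  shows "bounded_linear K"
proof -
  have K: "linear K" and "compact (closure (K ` cball 0 1))"
    using assms by (auto simp: compact_linear_def)
  then have "bounded (K ` cball 0 1)"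
    using bounded_subset[OF compact_imp_bounded closure_subset] by blast
  then obtain B where B: "\<And>x. norm x \<le> 1 \<Longrightarrow> norm (K x) \<le> B"
    unfolding bounded_iff by (metis imageI mem_cball_0)
  show ?thesis
  proof (rule bounded_linear_intro[of K B])
    fix x
    show "norm (K x) \<le> norm x * B"
    proof (cases "x = 0")
      case False
      have "norm (K (inverse (norm x) *\<^sub>R x)) \<le> B" using False by (intro B) simp
      then show ?thesis using False by (simp add: linear_cmul[OF K] field_simps)
    qed (simp add: linear_0[OF K])
  qed (simp_all add: linear_add[OF K] linear_cmul[OF K])
qed

theorem corollary4p5:
  fixes T p q r :: real
    and K :: "'x::banach \<Rightarrow> 'y::banach"
    and S :: "real \<Rightarrow> 'y \<Rightarrow>\<^sub>L 'y"
    and \<Omega> :: "real \<Rightarrow> 'x \<Rightarrow> ennreal"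
    and \<alpha> :: "real \<Rightarrow> real \<Rightarrow> real"
    and y :: "real \<Rightarrow> 'y"
    and y\<delta> :: "real \<Rightarrow> real \<Rightarrow> 'y"
  assumes "T > 0" and "1 \<le> p" and "1 \<le> q" and "1 < r"
    and "reflexive_space TYPE('x)" and "reflexive_space TYPE('y)"
    and "compact_linear K"
    and "bdd_above ((\<lambda>t. norm (S t)) ` {0<..<T})"
    and "\<And>\<theta>. \<theta> \<in> bochner_space p T \<Longrightarrow> temporal_operator S K \<theta> \<in> bochner_space q T"
    and "\<And>(u :: real \<Rightarrow> 'x) e. u \<in> bochner_space p T \<Longrightarrow> e > 0 \<Longrightarrow>
           \<exists>v\<in>cont_domain p T. bochner_norm p T (\<lambda>t. u t - v t) < e"
    and "\<And>t. t \<in> {0..T} \<Longrightarrow> proper_fun (\<Omega> t)"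
    and "\<And>t. t \<in> {0..T} \<Longrightarrow> convex_fun (\<Omega> t)"
    and "\<And>t. t \<in> {0..T} \<Longrightarrow> lower_semicont (\<Omega> t)"
    and "\<And>t. t \<in> {0..T} \<Longrightarrow> pointwise_domain p T t \<inter> effective_domain (\<Omega> t) \<noteq> {}"
    and "\<And>t (c::real). t \<in> {0..T} \<Longrightarrow> weakly_seq_precompact {x. \<Omega> t x \<le> ennreal c}"
    and "\<And>t. t \<in> {0..T} \<Longrightarrow> index_function (\<alpha> t)"
    and "\<And>t. t \<in> {0..T} \<Longrightarrow> (\<alpha> t \<longlongrightarrow> 0) (at_right 0)"
    and "\<And>t. t \<in> {0..T} \<Longrightarrow> ((\<lambda>\<delta>. \<delta> powr r / \<alpha> t \<delta>) \<longlongrightarrow> 0) (at_right 0)"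
    and "y \<in> bochner_space q T"
    and "\<And>\<delta>. \<delta> > 0 \<Longrightarrow> y\<delta> \<delta> \<in> bochner_space q T"
    and "\<And>\<delta>. \<delta> > 0 \<Longrightarrow> bochner_norm q T (\<lambda>t. y t - y\<delta> \<delta> t) < \<delta>"
    and "\<And>\<delta> t. \<delta> > 0 \<Longrightarrow> t \<in> {0..T} \<Longrightarrow>
           y\<delta> \<delta> t \<in> temporal_pointwise S K t ` pointwise_domain p T t"
    and "\<exists>\<theta>\<in>cont_domain p T. AE t in lebesgue_on {0<..<T}. temporal_operator S K \<theta> t = y t"
    and "\<And>t. t \<in> {0..T} \<Longrightarrow> y t \<in> temporal_pointwise S K t ` pointwise_domain p T t"
  shows "(\<forall>t\<in>{0..T}. \<forall>\<delta>>0. \<forall>a>0. \<exists>x.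
            is_arg_min (tikhonov r (temporal_pointwise S K t) (y\<delta> \<delta> t) a (\<Omega> t))
              (\<lambda>x. x \<in> pointwise_domain p T t) x)
       \<and> (\<forall>\<delta> :: nat \<Rightarrow> real. (\<forall>n. \<delta> n > 0) \<longrightarrow> \<delta> \<longlonglongrightarrow> 0 \<longrightarrow>
            (AE t in lebesgue_on {0<..<T}.
               (\<exists>z\<in>effective_domain (\<Omega> t). temporal_pointwise S K t z = y t) \<longrightarrow>
               (\<forall>x. (\<forall>n. is_arg_min
                           (tikhonov r (temporal_pointwise S K t) (y\<delta> (\<delta> n) t) (\<alpha> t (\<delta> n)) (\<Omega> t))
                           (\<lambda>x. x \<in> pointwise_domain p T t) (x n)) \<longrightarrow>
                  (\<exists>\<phi> l. strict_mono (\<phi> :: nat \<Rightarrow> nat) \<and> weakly_converges (x \<circ> \<phi>) l \<and>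
                     minimizing_solution (temporal_pointwise S K t) (y t) (\<Omega> t) l))))"
proof -
  let ?F = "temporal_pointwise S K"
  have F: "bounded_linear (?F t)" for t
    unfolding temporal_pointwise_def[abs_def]
    by (rule bounded_linear_compose[OF blinfun.bounded_linear_right
          bounded_linear_compact_linear[OF assms(7)]])
  have r: "0 < r" using assms(4) by simp
  have minimizers: "\<exists>x. is_arg_min (tikhonov r (?F t) (y\<delta> \<delta> t) a (\<Omega> t))
      (\<lambda>x. x \<in> pointwise_domain p T t) x" if "t \<in> {0..T}" "0 < a" for t \<delta> a
    using tikhonov_minimizer_ex[OF F r that(2) assms(11,12,13)[OF that(1)] assms(15)[OF that(1)]]
    by (simp add: is_arg_min_linorder pointwise_domain_eq_UNIV)
  have convergence: "AE t in lebesgue_on {0<..<T}.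
      (\<exists>z\<in>effective_domain (\<Omega> t). ?F t z = y t) \<longrightarrow>
      (\<forall>x. (\<forall>n. is_arg_min (tikhonov r (?F t) (y\<delta> (\<delta> n) t) (\<alpha> t (\<delta> n)) (\<Omega> t))
              (\<lambda>x. x \<in> pointwise_domain p T t) (x n)) \<longrightarrow>
        (\<exists>\<phi> l. strict_mono (\<phi> :: nat \<Rightarrow> nat) \<and> weakly_converges (x \<circ> \<phi>) l \<and>
           minimizing_solution (?F t) (y t) (\<Omega> t) l))"
    if \<delta>: "\<And>n. 0 < \<delta> n" and \<delta>0: "\<delta> \<longlonglongrightarrow> 0" for \<delta> :: "nat \<Rightarrow> real"
  proof -
    have q: "0 < q" using assms(3) by simp
    have "AE t in lebesgue_on {0<..<T}. \<exists>C \<phi>. strict_mono (\<phi> :: nat \<Rightarrow> nat) \<and>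
        (\<forall>n. norm (y t - y\<delta> (\<delta> (\<phi> n)) t) \<le> C * \<delta> (\<phi> n))"
      using q \<delta> assms(21)[OF \<delta>] bochner_space_diff[OF less_imp_le[OF q] assms(19) assms(20)[OF \<delta>]]
      by (intro bochner_norm_less_imp_AE_subseq[where w = "\<lambda>n t. y t - y\<delta> (\<delta> n) t"])
    then show ?thesis
      using AE_space[of "lebesgue_on {0<..<T}"]
    proof eventually_elim
      case (elim t)
      then have t: "t \<in> {0..T}" by simp
      obtain C and \<phi> :: "nat \<Rightarrow> nat" where \<phi>: "strict_mono \<phi>"
        and C: "\<And>n. norm (y t - y\<delta> (\<delta> (\<phi> n)) t) \<le> C * \<delta> (\<phi> n)"
        using elim by auto
      have \<alpha>_pos: "0 < \<alpha> t d" if "0 < d" for d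
        using assms(16)[OF t] that strict_mono_onD[of "{0..}" "\<alpha> t" 0 d]
        by (auto simp: index_function_def)
      have \<delta>\<phi>: "filterlim (\<lambda>n. \<delta> (\<phi> n)) (at_right 0) sequentially"
        using LIMSEQ_subseq_LIMSEQ[OF \<delta>0 \<phi>] \<delta>
        by (auto simp: filterlim_at o_def less_imp_neq[OF \<delta>, THEN not_sym] intro!: always_eventually)
      have \<alpha>0: "(\<lambda>n. \<alpha> t (\<delta> (\<phi> n))) \<longlonglongrightarrow> 0"
        by (rule filterlim_compose[OF assms(17)[OF t] \<delta>\<phi>])
      have "(\<lambda>n. \<delta> (\<phi> n) powr r / \<alpha> t (\<delta> (\<phi> n))) \<longlonglongrightarrow> 0"
        by (rule filterlim_compose[OF assms(18)[OF t] \<delta>\<phi>])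
      from tendsto_mult_right_zero[OF this, of "C powr r"]
      have upper: "(\<lambda>n. C powr r * (\<delta> (\<phi> n) powr r / \<alpha> t (\<delta> (\<phi> n)))) \<longlonglongrightarrow> 0" .
      have noise: "(\<lambda>n. norm (y t - y\<delta> (\<delta> (\<phi> n)) t) powr r / \<alpha> t (\<delta> (\<phi> n))) \<longlonglongrightarrow> 0"
      proof (rule tendsto_sandwich[OF _ _ tendsto_const upper]; intro always_eventually allI)
        fix n
        have "norm (y t - y\<delta> (\<delta> (\<phi> n)) t) powr r \<le> (C * \<delta> (\<phi> n)) powr r"
          using C[of n] r by (intro powr_mono2) auto
        also have "\<dots> = C powr r * \<delta> (\<phi> n) powr r"
          by (rule powr_mult)
        finally show "norm (y t - y\<delta> (\<delta> (\<phi> n)) t) powr r / \<alpha> t (\<delta> (\<phi> n))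
            \<le> C powr r * (\<delta> (\<phi> n) powr r / \<alpha> t (\<delta> (\<phi> n)))"
          using \<alpha>_pos[OF \<delta>, of "\<phi> n"] by (simp add: divide_right_mono)
        show "0 \<le> norm (y t - y\<delta> (\<delta> (\<phi> n)) t) powr r / \<alpha> t (\<delta> (\<phi> n))"
          using \<alpha>_pos[OF \<delta>, of "\<phi> n"] by simp
      qed
      show ?case
      proof (intro impI allI, elim bexE)
        fix x z
        assume x: "\<forall>n. is_arg_min (tikhonov r (?F t) (y\<delta> (\<delta> n) t) (\<alpha> t (\<delta> n)) (\<Omega> t))
            (\<lambda>x. x \<in> pointwise_domain p T t) (x n)"
          and z: "z \<in> effective_domain (\<Omega> t)" "?F t z = y t"
        have "\<exists>\<psi> l. strict_mono (\<psi> :: nat \<Rightarrow> nat) \<and> weakly_converges ((x \<circ> \<phi>) \<circ> \<psi>) l \<and>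
            minimizing_solution (?F t) (y t) (\<Omega> t) l"
        proof (rule tikhonov_minimizers_subseq_converge[OF F r _ assms(12,13)[OF t] assms(15)[OF t]
              \<alpha>0 noise z(2)])
          show "\<Omega> t z < \<infinity>" using z(1) by (simp add: effective_domain_def)
          show "0 < \<alpha> t (\<delta> (\<phi> n))" for n by (rule \<alpha>_pos[OF \<delta>])
          show "tikhonov r (?F t) (y\<delta> (\<delta> (\<phi> n)) t) (\<alpha> t (\<delta> (\<phi> n))) (\<Omega> t) ((x \<circ> \<phi>) n)
              \<le> tikhonov r (?F t) (y\<delta> (\<delta> (\<phi> n)) t) (\<alpha> t (\<delta> (\<phi> n))) (\<Omega> t) u" for n u
            using x by (simp add: is_arg_min_linorder pointwise_domain_eq_UNIV)
        qed
        then obtain \<psi> :: "nat \<Rightarrow> nat" and l where "strict_mono \<psi>" "weakly_converges ((x \<circ> \<phi>) \<circ> \<psi>) l"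
          "minimizing_solution (?F t) (y t) (\<Omega> t) l"
          by blast
        then show "\<exists>\<phi> l. strict_mono (\<phi> :: nat \<Rightarrow> nat) \<and> weakly_converges (x \<circ> \<phi>) l \<and>
            minimizing_solution (?F t) (y t) (\<Omega> t) l"
          by (intro exI[of _ "\<phi> \<circ> \<psi>"] exI[of _ l]) (simp add: strict_mono_o[OF \<phi>] o_assoc)
      qed
    qed
  qed
  show ?thesis
    using minimizers convergence by blast
qed

end
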